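(* Let $S$ be a finite $p$-group for an odd prime $p$. Then $J(S)\leq \mathfrak{X}(S)$ if and only if $\mathfrak{X}(L)=\mathfrak{X}(S)$ for every subgroup $L$ of $S$ with $\mathfrak{X}(S)\leq L\leq J(S)\mathfrak{X}(S)$.
   Context: For a finite $p$-group $G$ and subgroups $A,B$, write $[A,B;1]=[A,B]$ and $[A,B;k]=[[A,B;k-1],B]$. $\Omega_1(G)$ denotes the subgroup generated by the elements of order $p$ in $G$. The Oliver subgroup $\mathfrak{X}(G)$ of a finite $p$-group $G$ is the unique largest normal subgroup $K$ of $G$ admitting a chain $1=Q_0\leq Q_1\leq\cdots\leq Q_n=K$ of normal subgroups $Q_i\unlhd G$ such that $[\Omega_1(C_G(Q_{i-1})),Q_i;p-1]=1$ for each $1\leq i\leq n$. For a subgroup $L\leq S$, $\mathfrak{X}(L)$ is the Oliver subgroup of $L$ regarded as a $p$-group in its own right. $J(S)$ is the Thompson subgroup of $S$: the subgroup generated by all elementary abelian $p$-subgroups of $S$ whose rank equals the $p$-rank of $S$ (the largest rank of an elementary abelian $p$-subgroup of $S$). *)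

theory Defs
  imports "HOL-Algebra.Algebra" "HOL-Computational_Algebra.Primes"
begin

definition commutator_subgroup :: "('a, 'b) monoid_scheme \<Rightarrow> 'a set \<Rightarrow> 'a set \<Rightarrow> 'a set" where
  "commutator_subgroup G A B =
     generate G (\<Union>a \<in> A. \<Union>b \<in> B. {a \<otimes>\<^bsub>G\<^esub> b \<otimes>\<^bsub>G\<^esub> inv\<^bsub>G\<^esub> a \<otimes>\<^bsub>G\<^esub> inv\<^bsub>G\<^esub> b})"

fun comm_iter :: "('a, 'b) monoid_scheme \<Rightarrow> 'a set \<Rightarrow> 'a set \<Rightarrow> nat \<Rightarrow> 'a set" where
  "comm_iter G A B 0 = A"
| "comm_iter G A B (Suc k) = commutator_subgroup G (comm_iter G A B k) B"

definition centralizer :: "('a, 'b) monoid_scheme \<Rightarrow> 'a set \<Rightarrow> 'a set" where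
  "centralizer G Q = {g \<in> carrier G. \<forall>q \<in> Q. g \<otimes>\<^bsub>G\<^esub> q = q \<otimes>\<^bsub>G\<^esub> g}"

definition Omega1 :: "('a, 'b) monoid_scheme \<Rightarrow> nat \<Rightarrow> 'a set \<Rightarrow> 'a set" where
  "Omega1 G p H = generate G {x \<in> H. group.ord G x = p}"

definition oliver_chain :: "('a, 'b) monoid_scheme \<Rightarrow> nat \<Rightarrow> 'a set \<Rightarrow> bool" where
  "oliver_chain G p K \<longleftrightarrow>
     (\<exists>(n::nat) (Q :: nat \<Rightarrow> 'a set).
        Q 0 = {\<one>\<^bsub>G\<^esub>} \<and> Q n = K \<and>
        (\<forall>i \<le> n. Q i \<lhd> G) \<and>
        (\<forall>i < n. Q i \<subseteq> Q (Suc i)) \<and>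
        (\<forall>i. 1 \<le> i \<and> i \<le> n \<longrightarrow>
           comm_iter G (Omega1 G p (centralizer G (Q (i - 1)))) (Q i) (p - 1) = {\<one>\<^bsub>G\<^esub>}))"

definition oliver_subgroup :: "('a, 'b) monoid_scheme \<Rightarrow> nat \<Rightarrow> 'a set" where
  "oliver_subgroup G p =
     (THE K. K \<lhd> G \<and> oliver_chain G p K \<and> (\<forall>K'. K' \<lhd> G \<and> oliver_chain G p K' \<longrightarrow> K' \<subseteq> K))"

definition elementary_abelian :: "('a, 'b) monoid_scheme \<Rightarrow> nat \<Rightarrow> 'a set \<Rightarrow> bool" where
  "elementary_abelian G p E \<longleftrightarrow>
     subgroup E G \<and>
     (\<forall>x \<in> E. \<forall>y \<in> E. x \<otimes>\<^bsub>G\<^esub> y = y \<otimes>\<^bsub>G\<^esub> x) \<and>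
     (\<forall>x \<in> E. x [^]\<^bsub>G\<^esub> p = \<one>\<^bsub>G\<^esub>)"

text \<open>The rank of an elementary abelian p-group E (of order p^r) is r.\<close>
definition el_rank :: "nat \<Rightarrow> 'a set \<Rightarrow> nat" where
  "el_rank p E = Factorial_Ring.multiplicity p (card E)"

definition p_rank :: "('a, 'b) monoid_scheme \<Rightarrow> nat \<Rightarrow> nat" where
  "p_rank G p = Max {el_rank p E | E. elementary_abelian G p E}"

definition thompson_subgroup :: "('a, 'b) monoid_scheme \<Rightarrow> nat \<Rightarrow> 'a set" where
  "thompson_subgroup G p =
     generate G (\<Union>{E. elementary_abelian G p E \<and> el_rank p E = p_rank G p})"

definition p_group :: "('a, 'b) monoid_scheme \<Rightarrow> nat \<Rightarrow> bool" where
  "p_group G p \<longleftrightarrow> group G \<and> finite (carrier G) \<and> Factorial_Ring.prime p \<and> (\<exists>n. order G = p ^ n)"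

end

theory Submission
  imports Defs
begin

text \<open>Write \<open>\<XX> = \<XX>(S)\<close>, \<open>\<VV> = \<Omega>\<^sub>1(C\<^sub>S(\<XX>))\<close> and \<open>J = J(S)\<close>. As \<open>p\<close> is odd, a normal subgroup \<open>R\<close> with
  \<open>[\<VV>, R; 2] = 1\<close> prolongs a chain for \<open>\<XX>\<close> to one for \<open>\<XX> R\<close>, hence lies in \<open>\<XX>\<close>. For \<open>R\<close> a
  self-centralizing abelian normal subgroup this gives \<open>C\<^sub>S(\<XX>) \<le> \<XX>\<close>, so that \<open>\<VV>\<close> is elementary
  abelian; for \<open>R = C\<^sub>S(\<VV>)\<close> it gives \<open>C\<^sub>S(\<VV>) = \<XX>\<close>. If \<open>J\<close> is not contained in \<open>\<XX>\<close>, choose an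
  elementary abelian subgroup \<open>A\<close> of maximal rank not contained in \<open>\<XX>\<close> with \<open>A \<inter> \<VV>\<close> maximal.
  Thompson replacement and \<open>C\<^sub>S(\<VV>) = \<XX>\<close> show that \<open>[\<VV>, A; 2] = 1\<close>, so \<open>\<XX> A\<close> is its own Oliver
  subgroup and properly contains \<open>\<XX>\<close>. Conversely, if \<open>J \<le> \<XX>\<close> then only \<open>L = \<XX>\<close> has to be
  considered, and a chain for \<open>\<XX>\<close> in \<open>S\<close> is also one in \<open>\<XX>\<close>.\<close>

section \<open>Commutators and centralizers\<close>

definition commutator :: "('a, 'b) monoid_scheme \<Rightarrow> 'a \<Rightarrow> 'a \<Rightarrow> 'a" where
  "commutator G a b = a \<otimes>\<^bsub>G\<^esub> b \<otimes>\<^bsub>G\<^esub> inv\<^bsub>G\<^esub> a \<otimes>\<^bsub>G\<^esub> inv\<^bsub>G\<^esub> b"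

context group
begin

lemma inv_mult_cancel:
  assumes "x \<in> carrier G" "y \<in> carrier G"
  shows "inv x \<otimes> (x \<otimes> y) = y" "x \<otimes> (inv x \<otimes> y) = y"
  using assms by (simp_all add: m_assoc [symmetric])

lemmas group_cancel = m_assoc inv_mult_group inv_mult_cancel

lemma commutator_closed [simp]:
  "a \<in> carrier G \<Longrightarrow> b \<in> carrier G \<Longrightarrow> commutator G a b \<in> carrier G"
  by (simp add: commutator_def)

lemma commutator_mult_left:
  assumes "a \<in> carrier G" "b \<in> carrier G" "c \<in> carrier G"
  shows "commutator G (a \<otimes> b) c = a \<otimes> commutator G b c \<otimes> inv a \<otimes> commutator G a c"
  using assms by (simp add: commutator_def group_cancel)

lemma commutator_mult_right:
  assumes "a \<in> carrier G" "b \<in> carrier G" "c \<in> carrier G"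
  shows "commutator G a (b \<otimes> c) = commutator G a b \<otimes> (b \<otimes> commutator G a c \<otimes> inv b)"
  using assms by (simp add: commutator_def group_cancel)

lemma commutator_inv_left:
  assumes "a \<in> carrier G" "b \<in> carrier G"
  shows "commutator G (inv a) b = inv a \<otimes> inv (commutator G a b) \<otimes> a"
  using assms by (simp add: commutator_def group_cancel)

lemma conjugate_eq_inv_commutator_mult:
  assumes "a \<in> carrier G" "b \<in> carrier G"
  shows "b \<otimes> a \<otimes> inv b = inv (commutator G a b) \<otimes> a"
  using assms by (simp add: commutator_def group_cancel)

lemma commutator_eq_one_iff:
  assumes "a \<in> carrier G" "b \<in> carrier G"
  shows "commutator G a b = \<one> \<longleftrightarrow> a \<otimes> b = b \<otimes> a"
proof -
  have "commutator G a b = (a \<otimes> b) \<otimes> inv (b \<otimes> a)"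
    using assms by (simp add: commutator_def group_cancel)
  then show ?thesis
    using assms by (metis inv_solve_right' l_one m_closed one_closed)
qed

lemma commutator_in_normal:
  assumes "N \<lhd> G" "n \<in> N" "g \<in> carrier G"
  shows "commutator G n g \<in> N" "commutator G g n \<in> N"
proof -
  interpret N: normal N G by fact
  have n: "n \<in> carrier G" using assms(2) by simp
  have "n \<otimes> (g \<otimes> inv n \<otimes> inv g) \<in> N" "(g \<otimes> n \<otimes> inv g) \<otimes> inv n \<in> N"
    using N.inv_op_closed2 [OF assms(3)] assms(2) by simp_all
  then show "commutator G n g \<in> N" "commutator G g n \<in> N"
    using n assms(3) by (simp_all add: commutator_def m_assoc)
qed

text \<open>With \<open>V\<close> written additively \<open>[x, d]\<close> becomes \<open>(1 - d) x\<close>, and \<open>1 - d\<close> commutes with \<open>1 - e\<close>.\<close>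

lemma commutator_commutator_commute:
  assumes V: "V \<lhd> G" "V \<subseteq> centralizer G V" and x: "x \<in> V"
    and de: "d \<in> carrier G" "e \<in> carrier G" "d \<otimes> e = e \<otimes> d"
  shows "commutator G (commutator G x d) e = commutator G (commutator G x e) d"
proof -
  interpret V: normal V G by fact
  define conj where "conj g v = g \<otimes> v \<otimes> inv g" for g v
  have conj_V: "conj g v \<in> V" if "g \<in> carrier G" "v \<in> V" for g v
    using that by (simp add: conj_def V.inv_op_closed2)
  have expand: "commutator G (commutator G x d) e
      = x \<otimes> inv (conj d x) \<otimes> (conj (e \<otimes> d) x \<otimes> inv (conj e x))"
    if "d \<in> carrier G" "e \<in> carrier G" for d e
    using that x by (simp add: commutator_def conj_def group_cancel)
  have commute: "u \<otimes> v = v \<otimes> u" if "u \<in> V" "v \<in> V" for u v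
    using that V(2) by (auto simp: centralizer_def)
  let ?u = "inv (conj d x)" and ?v = "conj (e \<otimes> d) x" and ?w = "inv (conj e x)"
  have "?u \<in> V" "?v \<in> V" "?w \<in> V"
    using x de conj_V by simp_all
  then have "x \<otimes> ?u \<otimes> (?v \<otimes> ?w) = x \<otimes> ?w \<otimes> (?v \<otimes> ?u)"
    using x commute [of "?u" "?v \<otimes> ?w"] commute [of "?v" "?w"] by (simp add: m_assoc)
  then show ?thesis
    using de by (simp add: expand)
qed

lemma centralizer_subset_carrier: "centralizer G Q \<subseteq> carrier G"
  by (auto simp: centralizer_def)

lemma centralizer_antimono:
  "Q \<subseteq> R \<Longrightarrow> centralizer G R \<subseteq> centralizer G Q"
  by (auto simp: centralizer_def)

lemma subset_centralizer_swap:
  assumes "A \<subseteq> centralizer G B" "B \<subseteq> carrier G"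
  shows "B \<subseteq> centralizer G A"
  using assms by (auto simp: centralizer_def subset_iff)

lemma centralizer_is_subgroup:
  assumes "Q \<subseteq> carrier G"
  shows "subgroup (centralizer G Q) G"
proof (rule subgroupI)
  show "centralizer G Q \<noteq> {}"
    using assms by (auto simp: centralizer_def intro!: exI [of _ \<one>])
next
  fix a b assume a: "a \<in> centralizer G Q" and b: "b \<in> centralizer G Q"
  have carr: "a \<in> carrier G" "b \<in> carrier G" "q \<in> carrier G"
    and commute: "a \<otimes> q = q \<otimes> a" "b \<otimes> q = q \<otimes> b" if "q \<in> Q" for q
    using a b that assms by (auto simp: centralizer_def)
  have "inv a \<otimes> q = q \<otimes> inv a" if "q \<in> Q" for q
    using carr [OF that] commute(1) [OF that]
    by (metis inv_closed inv_solve_left inv_solve_right' m_assoc m_closed)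
  then show "inv a \<in> centralizer G Q"
    using a by (simp add: centralizer_def)
  have "a \<otimes> b \<otimes> q = q \<otimes> (a \<otimes> b)" if "q \<in> Q" for q
    using carr [OF that] commute [OF that] by (metis m_assoc)
  then show "a \<otimes> b \<in> centralizer G Q"
    using a b by (simp add: centralizer_def)
qed (auto simp: centralizer_def)

lemma subgroup_Int_centralizer:
  "subgroup A G \<Longrightarrow> Q \<subseteq> carrier G \<Longrightarrow> subgroup (A \<inter> centralizer G Q) G"
  by (intro subgroups_Inter_pair centralizer_is_subgroup)

lemma centralizer_is_normal:
  assumes "Q \<lhd> G"
  shows "centralizer G Q \<lhd> G"
proof (rule normal_invI)
  interpret Q: normal Q G by fact
  show "subgroup (centralizer G Q) G"
    by (rule centralizer_is_subgroup [OF Q.subset])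
  fix x h assume x: "x \<in> carrier G" and h: "h \<in> centralizer G Q"
  have "x \<otimes> h \<otimes> inv x \<otimes> q = q \<otimes> (x \<otimes> h \<otimes> inv x)" if q: "q \<in> Q" for q
  proof -
    have carr: "h \<in> carrier G" "q \<in> carrier G"
      using h q by (auto simp: centralizer_def)
    have "h \<otimes> (inv x \<otimes> q \<otimes> x) = (inv x \<otimes> q \<otimes> x) \<otimes> h"
      using h Q.inv_op_closed1 [OF x q] by (simp add: centralizer_def)
    then have "x \<otimes> (h \<otimes> (inv x \<otimes> q \<otimes> x)) \<otimes> inv x = x \<otimes> ((inv x \<otimes> q \<otimes> x) \<otimes> h) \<otimes> inv x"
      by simp
    then show ?thesis
      using x carr by (simp add: group_cancel)
  qed
  then show "x \<otimes> h \<otimes> inv x \<in> centralizer G Q"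
    using x h by (simp add: centralizer_def)
qed

lemma centralizer_generate:
  assumes "T \<subseteq> carrier G"
  shows "centralizer G (generate G T) = centralizer G T"
proof
  show "centralizer G (generate G T) \<subseteq> centralizer G T"
    by (intro centralizer_antimono subsetI generate.incl)
  have "generate G T \<subseteq> centralizer G (centralizer G T)"
    using assms subset_centralizer_swap [OF order_refl assms]
    by (intro generate_subgroup_incl centralizer_is_subgroup centralizer_subset_carrier)
  then show "centralizer G T \<subseteq> centralizer G (generate G T)"
    by (rule subset_centralizer_swap [OF _ centralizer_subset_carrier])
qed

lemma generate_abelian:
  assumes "T \<subseteq> centralizer G T"
  shows "generate G T \<subseteq> centralizer G (generate G T)"
proof -
  have T: "T \<subseteq> carrier G"
    using assms centralizer_subset_carrier by blast
  show ?thesis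
    unfolding centralizer_generate [OF T]
    by (intro generate_subgroup_incl assms centralizer_is_subgroup T)
qed

lemma generate_is_normal:
  assumes T: "T \<subseteq> carrier G"
    and conj: "\<And>t g. t \<in> T \<Longrightarrow> g \<in> carrier G \<Longrightarrow> g \<otimes> t \<otimes> inv g \<in> generate G T"
  shows "generate G T \<lhd> G"
proof -
  let ?T = "{g \<otimes> t \<otimes> inv g | t g. t \<in> T \<and> g \<in> carrier G}"
  have "generate G ?T \<lhd> G"
  proof (rule normal_generateI)
    fix h g assume "h \<in> ?T" and g: "g \<in> carrier G"
    then obtain t k where t: "t \<in> T" and k: "k \<in> carrier G" and h: "h = k \<otimes> t \<otimes> inv k"
      by blast
    have "g \<otimes> h \<otimes> inv g = (g \<otimes> k) \<otimes> t \<otimes> inv (g \<otimes> k)"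
      using t k g T by (simp add: h group_cancel subset_iff)
    then show "g \<otimes> h \<otimes> inv g \<in> ?T"
      using t k g by blast
  qed (use T in auto)
  moreover have "T \<subseteq> ?T"
    using T by (force intro: exI [of _ \<one>])
  then have "generate G ?T = generate G T"
    by (intro subset_antisym generate_subgroup_incl generate_is_subgroup T mono_generate)
      (use conj in auto)
  ultimately show ?thesis
    by simp
qed

lemma generate_insert_abelian_normal:
  assumes D: "D \<lhd> G" "D \<subseteq> centralizer G D"
    and g: "g \<in> centralizer G D" "\<And>h. h \<in> carrier G \<Longrightarrow> commutator G g h \<in> D"
  defines "E \<equiv> generate G (insert g D)"
  shows "E \<lhd> G" "E \<subseteq> centralizer G E"
proof -
  interpret D: normal D G by (rule D(1))
  have g_carrier: "g \<in> carrier G"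
    using g(1) by (simp add: centralizer_def)
  have "insert g D \<subseteq> centralizer G (insert g D)"
    using g(1) D(2) by (auto simp: centralizer_def)
  then show "E \<subseteq> centralizer G E"
    unfolding E_def by (rule generate_abelian)
  show "E \<lhd> G"
    unfolding E_def
  proof (rule generate_is_normal)
    fix t h assume t: "t \<in> insert g D" and h: "h \<in> carrier G"
    have "inv (commutator G g h) \<otimes> g \<in> generate G (insert g D)"
      using g(2) [OF h] by (intro generate.eng) (auto intro: generate.incl)
    moreover have "h \<otimes> t \<otimes> inv h \<in> generate G (insert g D)" if "t \<in> D"
      using D.inv_op_closed2 [OF h that] by (auto intro: generate.incl)
    ultimately show "h \<otimes> t \<otimes> inv h \<in> generate G (insert g D)"
      using t h g_carrier by (auto simp: conjugate_eq_inv_commutator_mult)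
  qed (use g_carrier D.subset in auto)
qed

lemma subset_set_mult_left:
  "K \<subseteq> carrier G \<Longrightarrow> subgroup H G \<Longrightarrow> K \<subseteq> K <#> H"
  unfolding set_mult_def by (force dest: subgroup.one_closed)

lemma subset_set_mult_right:
  "H \<subseteq> carrier G \<Longrightarrow> subgroup K G \<Longrightarrow> H \<subseteq> K <#> H"
  unfolding set_mult_def by (force dest: subgroup.one_closed)

lemma lagrange_restrict:
  assumes "subgroup H G" "subgroup C G" "C \<subseteq> H"
  shows "card (rcosets\<^bsub>G\<lparr>carrier := H\<rparr>\<^esub> C) * card C = card H"
  using group.lagrange [OF subgroup_imp_group [OF assms(1)] subgroup_incl [OF assms(2,1,3)]]
  by (simp add: order_def)

lemma set_mult_commuting_is_subgroup:
  assumes E: "subgroup E G" and F: "subgroup F G" and EF: "F \<subseteq> centralizer G E"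
  shows "subgroup (E <#> F) G"
proof (rule subgroupI)
  interpret E: subgroup E G by fact
  interpret F: subgroup F G by fact
  have commute: "f \<otimes> e = e \<otimes> f" if "e \<in> E" "f \<in> F" for e f
    using EF that by (auto simp: centralizer_def)
  show "E <#> F \<subseteq> carrier G"
    by (intro setmult_subset_G E.subset F.subset)
  show "E <#> F \<noteq> {}"
    using E.one_closed F.one_closed unfolding set_mult_def by blast
  fix a b assume "a \<in> E <#> F" "b \<in> E <#> F"
  then obtain e f e' f' where a: "e \<in> E" "f \<in> F" "a = e \<otimes> f" and b: "e' \<in> E" "f' \<in> F" "b = e' \<otimes> f'"
    by (auto simp: set_mult_def)
  have "inv a = inv e \<otimes> inv f"
    using a commute by (simp add: inv_mult_group)
  then show "inv a \<in> E <#> F"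
    using a by (auto simp: set_mult_def)
  have "a \<otimes> b = e \<otimes> (f \<otimes> e') \<otimes> f'"
    using a b by (simp add: m_assoc)
  also have "\<dots> = (e \<otimes> e') \<otimes> (f \<otimes> f')"
    using a b commute by (simp add: m_assoc)
  finally show "a \<otimes> b \<in> E <#> F"
    using a b by (auto simp: set_mult_def)
qed

end

section \<open>Commutator subgroups\<close>

lemma commutator_subgroup_eq:
  "commutator_subgroup G A B = generate G {commutator G a b | a b. a \<in> A \<and> b \<in> B}"
  unfolding commutator_subgroup_def commutator_def by (rule arg_cong [of _ _ "generate G"]) blast

context group
begin

lemma commutator_subgroup_subset:
  assumes "subgroup H G" "\<And>a b. a \<in> A \<Longrightarrow> b \<in> B \<Longrightarrow> commutator G a b \<in> H"
  shows "commutator_subgroup G A B \<subseteq> H"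
  unfolding commutator_subgroup_eq using assms by (intro generate_subgroup_incl) auto

lemma commutator_in_commutator_subgroup:
  "a \<in> A \<Longrightarrow> b \<in> B \<Longrightarrow> commutator G a b \<in> commutator_subgroup G A B"
  unfolding commutator_subgroup_eq by (rule generate.incl) blast

lemma commutator_subgroup_subset_normal:
  assumes "N \<lhd> G" "A \<subseteq> N" "B \<subseteq> carrier G"
  shows "commutator_subgroup G A B \<subseteq> N"
  using assms commutator_in_normal(1) [OF assms(1)]
  by (intro commutator_subgroup_subset normal_imp_subgroup) auto

lemma commutator_subgroup_mono:
  "A \<subseteq> A' \<Longrightarrow> B \<subseteq> B' \<Longrightarrow> commutator_subgroup G A B \<subseteq> commutator_subgroup G A' B'"
  unfolding commutator_subgroup_eq by (intro mono_generate) blast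

lemma commutator_subgroup_is_subgroup:
  assumes "A \<subseteq> carrier G" "B \<subseteq> carrier G"
  shows "subgroup (commutator_subgroup G A B) G"
  unfolding commutator_subgroup_eq using assms by (intro generate_is_subgroup) (auto simp: subset_iff)

lemma commutator_subgroup_eq_one_iff:
  assumes A: "A \<subseteq> carrier G" and B: "B \<subseteq> carrier G"
  shows "commutator_subgroup G A B = {\<one>} \<longleftrightarrow> A \<subseteq> centralizer G B"
proof
  assume "commutator_subgroup G A B = {\<one>}"
  then have "commutator G a b = \<one>" if "a \<in> A" "b \<in> B" for a b
    using commutator_in_commutator_subgroup that by blast
  then show "A \<subseteq> centralizer G B"
    using A B by (auto simp: centralizer_def commutator_eq_one_iff subset_iff)
next
  assume "A \<subseteq> centralizer G B"
  then have "commutator G a b = \<one>" if "a \<in> A" "b \<in> B" for a b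
    using that A B by (subst commutator_eq_one_iff) (auto simp: centralizer_def)
  then have "commutator_subgroup G A B \<subseteq> {\<one>}"
    by (intro commutator_subgroup_subset triv_subgroup) simp
  then show "commutator_subgroup G A B = {\<one>}"
    using subgroup.one_closed [OF commutator_subgroup_is_subgroup [OF A B]] by blast
qed

lemma comm_iter_mono:
  "A \<subseteq> A' \<Longrightarrow> B \<subseteq> B' \<Longrightarrow> comm_iter G A B k \<subseteq> comm_iter G A' B' k"
  by (induction k) (simp_all add: commutator_subgroup_mono)

lemma one_in_comm_iter:
  "\<one> \<in> A \<Longrightarrow> \<one> \<in> comm_iter G A B k"
  by (cases k) (auto simp: commutator_subgroup_eq intro: generate.one)

lemma comm_iter_subset_normal:
  assumes "N \<lhd> G" "A \<subseteq> N" "B \<subseteq> carrier G"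
  shows "comm_iter G A B k \<subseteq> N"
  using assms by (induction k) (simp_all add: commutator_subgroup_subset_normal)

lemma comm_iter_subset_carrier:
  "A \<subseteq> carrier G \<Longrightarrow> B \<subseteq> carrier G \<Longrightarrow> comm_iter G A B k \<subseteq> carrier G"
  by (rule comm_iter_subset_normal [OF normal_self])

lemma comm_iter_eq_one_mono:
  assumes B: "B \<subseteq> carrier G" and "comm_iter G A B j = {\<one>}" "j \<le> k"
  shows "comm_iter G A B k = {\<one>}"
  using assms(3)
proof (induction k rule: dec_induct)
  case (step k)
  then show ?case
    using B commutator_subgroup_eq_one_iff [of "{\<one>}" B] by (auto simp: centralizer_def)
qed (fact assms(2))

lemma comm_iter_two_eq_one_of_abelian_normal:
  assumes A: "A \<subseteq> carrier G" and D: "D \<lhd> G" "D \<subseteq> centralizer G D"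
  shows "comm_iter G A D 2 = {\<one>}"
proof -
  have D_carrier: "D \<subseteq> carrier G"
    using D(2) centralizer_subset_carrier by blast
  have "commutator_subgroup G A D \<subseteq> D"
    using A commutator_in_normal(2) [OF D(1)]
    by (intro commutator_subgroup_subset normal_imp_subgroup D(1)) auto
  with D(2) have "commutator_subgroup G (commutator_subgroup G A D) D = {\<one>}"
    using D_carrier by (subst commutator_subgroup_eq_one_iff) auto
  then show ?thesis
    by (simp add: numeral_2_eq_2)
qed

lemma commutator_mult_right_centralized:
  assumes K: "K \<lhd> G" and "a \<in> centralizer G K" "k \<in> K" "r \<in> carrier G"
  shows "commutator G a (k \<otimes> r) = commutator G a r"
proof -
  have carr: "a \<in> carrier G" "k \<in> carrier G"
    using assms by (auto simp: centralizer_def dest: normal_imp_subgroup subgroup.mem_carrier)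
  have "commutator G a k = \<one>"
    using assms carr by (simp add: commutator_eq_one_iff centralizer_def)
  moreover have "commutator G a r \<in> centralizer G K"
    using assms by (intro commutator_in_normal centralizer_is_normal)
  then have "k \<otimes> commutator G a r = commutator G a r \<otimes> k"
    using assms(3) by (simp add: centralizer_def)
  then have "k \<otimes> commutator G a r \<otimes> inv k = commutator G a r"
    using carr assms(4) by (simp add: m_assoc)
  ultimately show ?thesis
    using carr assms by (simp add: commutator_mult_right)
qed

lemma comm_iter_set_mult_centralized:
  assumes K: "K \<lhd> G" and A: "A \<subseteq> centralizer G K" and R: "R \<subseteq> carrier G"
  shows "comm_iter G A (K <#> R) j = comm_iter G A R j"
proof (induction j)
  case (Suc j)
  let ?A = "comm_iter G A R j"
  have "?A \<subseteq> centralizer G K"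
    using assms by (intro comm_iter_subset_normal centralizer_is_normal)
  then have absorb: "commutator G a (k \<otimes> r) = commutator G a r"
    if "a \<in> ?A" "k \<in> K" "r \<in> R" for a k r
    using that R by (intro commutator_mult_right_centralized [OF K]) auto
  have "R \<subseteq> K <#> R"
    using K R by (intro subset_set_mult_right normal_imp_subgroup)
  then have "{commutator G a b | a b. a \<in> ?A \<and> b \<in> K <#> R} = {commutator G a b | a b. a \<in> ?A \<and> b \<in> R}"
    using absorb by (fastforce simp: set_mult_def)
  with Suc show ?case
    by (simp add: commutator_subgroup_eq)
qed simp

lemma commutator_subgroup_consistent:
  assumes L: "subgroup L G" and "A \<subseteq> L" "B \<subseteq> L"
  shows "commutator_subgroup (G\<lparr>carrier := L\<rparr>) A B = commutator_subgroup G A B"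
proof -
  have eq: "commutator (G\<lparr>carrier := L\<rparr>) a b = commutator G a b" and "commutator G a b \<in> L"
    if "a \<in> A" "b \<in> B" for a b
    using that assms
    by (auto simp: commutator_def m_inv_consistent subset_iff subgroup.m_closed subgroup.m_inv_closed)
  then have "{commutator G a b | a b. a \<in> A \<and> b \<in> B} \<subseteq> L"
    by blast
  moreover have "{commutator (G\<lparr>carrier := L\<rparr>) a b | a b. a \<in> A \<and> b \<in> B}
      = {commutator G a b | a b. a \<in> A \<and> b \<in> B}"
    using eq by metis
  ultimately show ?thesis
    by (simp add: commutator_subgroup_eq generate_consistent [OF _ L])
qed

lemma comm_iter_consistent:
  assumes L: "subgroup L G" and A: "A \<subseteq> L" and B: "B \<subseteq> L"
  shows "comm_iter (G\<lparr>carrier := L\<rparr>) A B k = comm_iter G A B k"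
proof (induction k)
  case (Suc k)
  interpret L: group "G\<lparr>carrier := L\<rparr>"
    by (rule subgroup_imp_group [OF L])
  have "comm_iter G A B k \<subseteq> L"
    using L.comm_iter_subset_carrier [of A B k] A B by (simp add: Suc)
  with Suc B show ?case
    by (simp add: commutator_subgroup_consistent [OF L])
qed simp

lemma centralizer_consistent:
  "L \<subseteq> carrier G \<Longrightarrow> centralizer (G\<lparr>carrier := L\<rparr>) Q = centralizer G Q \<inter> L"
  by (auto simp: centralizer_def)

end

section \<open>The subgroup generated by the elements of order \<open>p\<close>\<close>

context group
begin

lemma Omega1_mono:
  "H \<subseteq> K \<Longrightarrow> Omega1 G p H \<subseteq> Omega1 G p K"
  unfolding Omega1_def by (rule mono_generate) blast

lemma Omega1_subset:
  "subgroup H G \<Longrightarrow> Omega1 G p H \<subseteq> H"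
  unfolding Omega1_def by (rule generate_subgroup_incl) auto

lemma one_in_Omega1: "\<one> \<in> Omega1 G p H"
  unfolding Omega1_def by (rule generate.one)

lemma ord_conjugate:
  assumes "x \<in> carrier G" "g \<in> carrier G"
  shows "ord (g \<otimes> x \<otimes> inv g) = ord x"
proof -
  have "(g \<otimes> x \<otimes> inv g) [^] n = g \<otimes> x [^] n \<otimes> inv g" for n :: nat
    using assms by (induction n) (simp_all add: group_cancel)
  moreover have "g \<otimes> y \<otimes> inv g = \<one> \<longleftrightarrow> y = \<one>" if "y \<in> carrier G" for y
    using assms that conjugation_is_inj [of g y \<one>] by auto
  ultimately show ?thesis
    using assms by (subst ord_unique) (simp_all add: pow_eq_id)
qed

lemma Omega1_is_normal:
  assumes "H \<lhd> G"
  shows "Omega1 G p H \<lhd> G"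
proof -
  interpret H: normal H G by fact
  show ?thesis
    unfolding Omega1_def
    by (rule normal_generateI) (auto simp: H.inv_op_closed2 ord_conjugate)
qed

lemma Omega1_consistent:
  assumes L: "subgroup L G" and H: "H \<subseteq> L"
  shows "Omega1 (G\<lparr>carrier := L\<rparr>) p H = Omega1 G p H"
proof -
  have "group.ord (G\<lparr>carrier := L\<rparr>) x = ord x" for x
    using group.ord_def [OF subgroup_imp_group [OF L]]
    by (simp add: ord_def nat_pow_consistent [symmetric])
  then show ?thesis
    unfolding Omega1_def using H by (simp add: generate_consistent [OF _ L] subset_iff)
qed

end

section \<open>The Oliver subgroup\<close>

definition oliver_step :: "('a, 'b) monoid_scheme \<Rightarrow> nat \<Rightarrow> 'a set \<Rightarrow> 'a set \<Rightarrow> bool" where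
  "oliver_step G p Q R \<longleftrightarrow>
     R \<lhd> G \<and> Q \<subseteq> R \<and> comm_iter G (Omega1 G p (centralizer G Q)) R (p - 1) = {\<one>\<^bsub>G\<^esub>}"

context group
begin

lemma oliver_chain_iff_rtranclp:
  "oliver_chain G p K \<longleftrightarrow> (oliver_step G p)\<^sup>*\<^sup>* {\<one>} K"
proof
  assume "oliver_chain G p K"
  then obtain n Q where Q: "Q 0 = {\<one>}" "Q n = K" "\<And>i. i \<le> n \<Longrightarrow> Q i \<lhd> G"
      "\<And>i. i < n \<Longrightarrow> Q i \<subseteq> Q (Suc i)"
      "\<And>i. 1 \<le> i \<Longrightarrow> i \<le> n \<Longrightarrow>
         comm_iter G (Omega1 G p (centralizer G (Q (i - 1)))) (Q i) (p - 1) = {\<one>}"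
    unfolding oliver_chain_def by metis
  have "oliver_step G p (Q i) (Q (Suc i))" if "i < n" for i
    using Q(3-4) Q(5) [of "Suc i"] that by (simp add: oliver_step_def)
  with Q(1,2) show "(oliver_step G p)\<^sup>*\<^sup>* {\<one>} K"
    unfolding rtranclp_power relpowp_fun_conv by blast
next
  assume "(oliver_step G p)\<^sup>*\<^sup>* {\<one>} K"
  then obtain n Q where Q: "Q 0 = {\<one>}" "Q n = K"
      and step: "\<And>i. i < n \<Longrightarrow> oliver_step G p (Q i) (Q (Suc i))"
    unfolding rtranclp_power relpowp_fun_conv by blast
  have "Q i \<lhd> G" if "i \<le> n" for i
    using that Q(1) step one_is_normal by (cases i) (auto simp: oliver_step_def)
  moreover have "comm_iter G (Omega1 G p (centralizer G (Q (i - 1)))) (Q i) (p - 1) = {\<one>}"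
    if "1 \<le> i" "i \<le> n" for i
    using that step [of "i - 1"] by (simp add: oliver_step_def)
  ultimately show "oliver_chain G p K"
    unfolding oliver_chain_def using Q step
    by (intro exI [of _ n] exI [of _ Q]) (auto simp: oliver_step_def)
qed

lemma oliver_chain_normal: "oliver_chain G p K \<Longrightarrow> K \<lhd> G"
  unfolding oliver_chain_def by blast

lemma oliver_chain_step:
  "oliver_chain G p Q \<Longrightarrow> oliver_step G p Q R \<Longrightarrow> oliver_chain G p R"
  unfolding oliver_chain_iff_rtranclp by (rule rtranclp.rtrancl_into_rtrancl)

lemma oliver_step_set_mult:
  assumes K: "K \<lhd> G" and Q: "subgroup Q G" and step: "oliver_step G p Q R"
  shows "oliver_step G p (K <#> Q) (K <#> R)"
proof -
  interpret K: normal K G by fact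
  interpret Q: subgroup Q G by fact
  have R: "R \<lhd> G" and QR: "Q \<subseteq> R"
    using step by (simp_all add: oliver_step_def)
  let ?A = "Omega1 G p (centralizer G (K <#> Q))"
  have "subgroup (centralizer G (K <#> Q)) G"
    by (intro centralizer_is_subgroup setmult_subset_G K.subset Q.subset)
  then have "?A \<subseteq> centralizer G (K <#> Q)"
    by (rule Omega1_subset)
  also have "\<dots> \<subseteq> centralizer G K"
    by (intro centralizer_antimono subset_set_mult_left K.subset Q)
  finally have "comm_iter G ?A (K <#> R) (p - 1) = comm_iter G ?A R (p - 1)"
    using normal_imp_subgroup [OF R] by (intro comm_iter_set_mult_centralized K subgroup.subset)
  also have "\<dots> \<subseteq> comm_iter G (Omega1 G p (centralizer G Q)) R (p - 1)"
    by (intro comm_iter_mono Omega1_mono centralizer_antimono subset_set_mult_right Q.subset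
        K.subgroup_axioms order_refl)
  also have "\<dots> = {\<one>}"
    using step by (simp add: oliver_step_def)
  finally have "comm_iter G ?A (K <#> R) (p - 1) = {\<one>}"
    using one_in_comm_iter [OF one_in_Omega1] by blast
  then show ?thesis
    using normal_subgroup_set_mult_closed [OF K R] mono_set_mult [OF order_refl QR]
    by (simp add: oliver_step_def)
qed

text \<open>The products of \<open>K\<close> with the members of a chain for \<open>K'\<close> prolong a chain for \<open>K\<close>.\<close>

lemma oliver_chain_set_mult:
  assumes K: "oliver_chain G p K" and K': "oliver_chain G p K'"
  shows "oliver_chain G p (K <#> K')"
  using K' unfolding oliver_chain_iff_rtranclp [of p K']
proof (induction rule: rtranclp_induct)
  case base
  have "K \<subseteq> carrier G"
    using oliver_chain_normal [OF K] by (simp add: normal_imp_subgroup subgroup.subset)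
  then have "K <#> {\<one>} = K"
    unfolding set_mult_def by force
  then show ?case
    using K by simp
next
  case (step Q R)
  have "Q \<lhd> G"
    using step(1) by (intro oliver_chain_normal) (simp add: oliver_chain_iff_rtranclp)
  then show ?case
    using step oliver_chain_normal [OF K]
    by (blast intro: oliver_chain_step oliver_step_set_mult normal_imp_subgroup)
qed

lemma oliver_step_restrictI:
  assumes L: "subgroup L G" and R: "R \<lhd> G\<lparr>carrier := L\<rparr>" "Q \<subseteq> R"
    and triv: "comm_iter G (Omega1 G p (centralizer G Q)) R (p - 1) = {\<one>}"
  shows "oliver_step (G\<lparr>carrier := L\<rparr>) p Q R"
proof -
  let ?W = "Omega1 G p (centralizer G Q \<inter> L)"
  have RL: "R \<subseteq> L"
    using subgroup.subset [OF normal_imp_subgroup [OF R(1)]] by simp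
  have WL: "?W \<subseteq> L"
    unfolding Omega1_def using L by (intro generate_subgroup_incl) auto
  have "comm_iter G ?W R (p - 1) \<subseteq> comm_iter G (Omega1 G p (centralizer G Q)) R (p - 1)"
    by (intro comm_iter_mono Omega1_mono Int_lower1 order_refl)
  with triv have "comm_iter G ?W R (p - 1) = {\<one>}"
    using one_in_comm_iter [OF one_in_Omega1] by blast
  moreover have "Omega1 (G\<lparr>carrier := L\<rparr>) p (centralizer (G\<lparr>carrier := L\<rparr>) Q) = ?W"
    using L by (simp add: centralizer_consistent subgroup.subset Omega1_consistent)
  ultimately show ?thesis
    using R comm_iter_consistent [OF L WL RL] by (simp add: oliver_step_def)
qed

lemma oliver_chain_restrict:
  assumes L: "subgroup L G" and K: "oliver_chain G p K" "K \<subseteq> L"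
  shows "oliver_chain (G\<lparr>carrier := L\<rparr>) p K"
proof -
  interpret L: group "G\<lparr>carrier := L\<rparr>"
    by (rule subgroup_imp_group [OF L])
  show ?thesis
    using K unfolding oliver_chain_iff_rtranclp
  proof (induction rule: rtranclp_induct)
    case base
    show ?case
      using L.oliver_chain_iff_rtranclp [of p "{\<one>}"] by simp
  next
    case (step Q R)
    from step(2) have "Q \<subseteq> R" "R \<lhd> G"
        "comm_iter G (Omega1 G p (centralizer G Q)) R (p - 1) = {\<one>}"
      by (simp_all add: oliver_step_def)
    moreover from this step(4) have "R \<lhd> G\<lparr>carrier := L\<rparr>"
      by (intro normal_restrict_supergroup L)
    ultimately have "oliver_step (G\<lparr>carrier := L\<rparr>) p Q R"
      by (intro oliver_step_restrictI L)
    moreover have "oliver_chain (G\<lparr>carrier := L\<rparr>) p Q"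
      using step \<open>Q \<subseteq> R\<close> by blast
    ultimately show ?case
      by (rule L.oliver_chain_step [rotated])
  qed
qed

lemma oliver_subgroup_greatest_chain:
  assumes "finite (carrier G)"
  shows "oliver_chain G p (oliver_subgroup G p)"
    and "\<And>K. oliver_chain G p K \<Longrightarrow> K \<subseteq> oliver_subgroup G p"
proof -
  let ?chains = "{K. oliver_chain G p K}"
  have chain_subgroup: "subgroup K G" if "oliver_chain G p K" for K
    using oliver_chain_normal [OF that] by (rule normal_imp_subgroup)
  then have "?chains \<subseteq> Pow (carrier G)"
    by (auto dest: subgroup.mem_carrier)
  then have "finite ?chains"
    using assms finite_subset by blast
  moreover have "{\<one>} \<in> ?chains"
    by (simp add: oliver_chain_iff_rtranclp)
  ultimately obtain M where M: "oliver_chain G p M"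
      and maximal: "\<And>K. oliver_chain G p K \<Longrightarrow> M \<subseteq> K \<Longrightarrow> M = K"
    using finite_has_maximal [of ?chains] by blast
  have greatest: "K \<subseteq> M" if K: "oliver_chain G p K" for K
  proof -
    have "M \<subseteq> M <#> K" "K \<subseteq> M <#> K"
      using chain_subgroup [OF M] chain_subgroup [OF K]
      by (simp_all add: subset_set_mult_left subset_set_mult_right subgroup.subset)
    then show ?thesis
      using maximal [OF oliver_chain_set_mult [OF M K]] by blast
  qed
  then have "oliver_subgroup G p = M"
    unfolding oliver_subgroup_def using M
    by (intro the_equality) (blast intro: oliver_chain_normal)+
  with M greatest show "oliver_chain G p (oliver_subgroup G p)"
    and "\<And>K. oliver_chain G p K \<Longrightarrow> K \<subseteq> oliver_subgroup G p"
    by auto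
qed

lemma oliver_subgroup_restrict_eqI:
  assumes L: "subgroup L G" "finite L" and chain: "oliver_chain (G\<lparr>carrier := L\<rparr>) p L"
  shows "oliver_subgroup (G\<lparr>carrier := L\<rparr>) p = L"
proof -
  interpret L: group "G\<lparr>carrier := L\<rparr>"
    by (rule subgroup_imp_group [OF L(1)])
  let ?X = "oliver_subgroup (G\<lparr>carrier := L\<rparr>) p"
  have "oliver_chain (G\<lparr>carrier := L\<rparr>) p ?X" and "L \<subseteq> ?X"
    using L.oliver_subgroup_greatest_chain chain L(2) by simp_all
  moreover from this have "?X \<subseteq> L"
    using L.oliver_chain_normal normal_imp_subgroup subgroup.subset by fastforce
  ultimately show ?thesis
    by blast
qed

end

section \<open>Nilpotency of finite \<open>p\<close>-groups\<close>

lemma (in group_action) orbits_memD: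
  assumes orb: "orb \<in> orbits G E \<phi>" and x: "x \<in> orb"
  shows "x \<in> E" "orb = orbit G \<phi> x"
proof -
  show "x \<in> E"
    using assms orbits_coverture by blast
  then have "orbit G \<phi> x \<in> orbits G E \<phi>" "x \<in> orbit G \<phi> x"
    by (auto simp: orbits_def orbit_refl)
  then show "orb = orbit G \<phi> x"
    using disjoint_union [OF orb] x by blast
qed

lemma (in group_action) prime_dvd_card_moved_points:
  assumes p: "Factorial_Ring.prime p" "order G = p ^ n" and E: "finite E"
  shows "p dvd card {x \<in> E. \<exists>g\<in>carrier G. \<phi> g x \<noteq> x}"
proof -
  let ?moved = "\<lambda>x. \<exists>g\<in>carrier G. \<phi> g x \<noteq> x"
  have "p dvd (\<Sum>x\<in>orb. if ?moved x then 1 else 0)" if orb: "orb \<in> orbits G E \<phi>" for orb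
  proof -
    have singleton: "orb = {x} \<longleftrightarrow> \<not> ?moved x" if "x \<in> orb" for x
      using orbit_refl [OF orbits_memD(1) [OF orb that]]
      unfolding orbits_memD(2) [OF orb that] orbit_def by auto
    obtain x where x: "x \<in> orb"
      using orb orbit_refl by (auto simp: orbits_def)
    have "card orb dvd p ^ n"
      using orbit_stabilizer_theorem [OF orbits_memD(1) [OF orb x]] p(2) orbits_memD(2) [OF orb x]
      by (metis dvd_triv_left)
    then obtain i where i: "card orb = p ^ i"
      using p(1) by (auto simp: divides_primepow_nat)
    show ?thesis
    proof (cases i)
      case 0
      with i x have "orb = {x}"
        by (auto simp: card_1_singleton_iff)
      then show ?thesis
        using singleton [OF x] by simp
    next
      case (Suc j)
      then have "card orb \<noteq> 1"
        using i p(1) by (simp add: not_prime_1 prime_nat_iff)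
      then have "(\<Sum>x\<in>orb. if ?moved x then 1 else 0) = card orb"
        using singleton by (simp add: card_1_singleton_iff cong: sum.cong)
      then show ?thesis
        using i Suc by simp
    qed
  qed
  then have "p dvd (\<Sum>x\<in>E. if ?moved x then 1 else 0)"
    unfolding disjoint_sum [OF E, symmetric] by (rule dvd_sum)
  then show ?thesis
    using card_as_sums [OF refl E, of ?moved] by simp
qed

lemma (in group) centre_nontrivial_of_prime_power_order:
  assumes p: "Factorial_Ring.prime p" "order G = p ^ n" and "order G \<noteq> 1"
  shows "centralizer G (carrier G) \<noteq> {\<one>}"
proof
  let ?conj = "\<lambda>g. \<lambda>x\<in>carrier G. g \<otimes> x \<otimes> inv g"
  assume "centralizer G (carrier G) = {\<one>}"
  moreover have "g \<otimes> x \<otimes> inv g = x \<longleftrightarrow> x \<otimes> g = g \<otimes> x" if "g \<in> carrier G" "x \<in> carrier G" for g x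
    using that by (metis inv_solve_right' m_closed)
  then have "{x \<in> carrier G. \<exists>g\<in>carrier G. ?conj g x \<noteq> x} = carrier G - centralizer G (carrier G)"
    by (auto simp: centralizer_def)
  moreover have finite: "finite (carrier G)"
    using p by (simp add: order_gt_0_iff_finite [symmetric] prime_gt_0_nat)
  ultimately have "p dvd card (carrier G - {\<one>})"
    using group_action.prime_dvd_card_moved_points [OF action_by_conjugation p] by simp
  moreover have "p dvd card (carrier G)"
    using assms by (cases n) (simp_all add: order_def)
  moreover have "card (carrier G) = Suc (card (carrier G - {\<one>}))"
    using card_Suc_Diff1 [OF finite one_closed] by simp
  ultimately have "p dvd 1"
    by (metis Suc_eq_plus1 dvd_add_right_iff)
  with p(1) show False
    using not_prime_unit by blast
qed

context group
begin

definition centre_modulo :: "'a set \<Rightarrow> 'a set" where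
  "centre_modulo M = {g \<in> carrier G. \<forall>h\<in>carrier G. commutator G g h \<in> M}"

lemma subset_centre_modulo:
  assumes "M \<lhd> G"
  shows "M \<subseteq> centre_modulo M"
  using assms commutator_in_normal(1) [OF assms]
  by (auto simp: centre_modulo_def dest: normal_imp_subgroup subgroup.mem_carrier)

lemma centre_modulo_is_normal:
  assumes M: "M \<lhd> G"
  shows "centre_modulo M \<lhd> G"
proof (rule normal_invI)
  interpret M: normal M G by fact
  show sub: "subgroup (centre_modulo M) G"
  proof (rule subgroupI)
    show "centre_modulo M \<noteq> {}"
      using subset_centre_modulo [OF M] M.one_closed by blast
    fix a b assume a: "a \<in> centre_modulo M" and b: "b \<in> centre_modulo M"
    then have "commutator G (inv a) h \<in> M" "commutator G (a \<otimes> b) h \<in> M" if "h \<in> carrier G" for h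
      using that M.inv_op_closed1 M.inv_op_closed2
      by (simp_all add: centre_modulo_def commutator_inv_left commutator_mult_left)
    then show "inv a \<in> centre_modulo M" "a \<otimes> b \<in> centre_modulo M"
      using a b by (simp_all add: centre_modulo_def)
  qed (auto simp: centre_modulo_def)
  fix x g assume x: "x \<in> carrier G" and g: "g \<in> centre_modulo M"
  then have "inv (commutator G g x) \<in> centre_modulo M"
    using subset_centre_modulo [OF M] by (auto simp: centre_modulo_def)
  then show "x \<otimes> g \<otimes> inv x \<in> centre_modulo M"
    using x g subgroup.m_closed [OF sub]
    by (simp add: conjugate_eq_inv_commutator_mult centre_modulo_def)
qed

lemma commutator_subgroup_centre_modulo_subset:
  assumes "M \<lhd> G"
  shows "commutator_subgroup G (centre_modulo M) (carrier G) \<subseteq> M"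
  using assms by (intro commutator_subgroup_subset normal_imp_subgroup) (auto simp: centre_modulo_def)

end

locale finite_p_group = group G for G (structure) +
  fixes p :: nat
  assumes p_group: "p_group G p"
begin

lemma finite_carrier: "finite (carrier G)"
  and prime: "Factorial_Ring.prime p"
  using p_group by (auto simp: p_group_def)

lemma finite_subgroup: "subgroup H G \<Longrightarrow> finite H"
  using finite_carrier by (meson finite_subset subgroup.subset)

lemma finite_normal_subgroups: "finite {N. N \<lhd> G \<and> P N}"
proof (rule finite_subset)
  show "{N. N \<lhd> G \<and> P N} \<subseteq> Pow (carrier G)"
    by (auto dest: normal_imp_subgroup subgroup.mem_carrier)
qed (simp add: finite_carrier)

lemma dvd_order_eq_prime_power:
  assumes "m dvd order G"
  obtains k where "m = p ^ k"
  using assms p_group prime by (auto simp: p_group_def divides_primepow_nat)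

lemma centre_modulo_psubset:
  assumes M: "M \<lhd> G" "M \<noteq> carrier G"
  shows "M \<subset> centre_modulo M"
proof -
  interpret M: normal M G by (rule M(1))
  interpret Q: group "G Mod M" by (rule M.factorgroup_is_group)
  have order_eq: "order (G Mod M) * card M = order G"
    using lagrange [OF M.subgroup_axioms] by (simp add: order_def FactGroup_def)
  then have "order (G Mod M) dvd order G"
    by (metis dvd_triv_left)
  then obtain k where "order (G Mod M) = p ^ k"
    by (rule dvd_order_eq_prime_power)
  moreover have "order (G Mod M) \<noteq> 1"
    using order_eq M(2) card_subset_eq [OF finite_carrier M.subset] by (auto simp: order_def)
  ultimately have "centralizer (G Mod M) (carrier (G Mod M)) \<noteq> {M}"
    using Q.centre_nontrivial_of_prime_power_order [OF prime] by simp
  moreover have "M \<in> centralizer (G Mod M) (carrier (G Mod M))"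
    using subgroup.one_closed [OF Q.centralizer_is_subgroup [OF order_refl]] by simp
  ultimately obtain C where C: "C \<in> centralizer (G Mod M) (carrier (G Mod M))" "C \<noteq> M"
    by blast
  then obtain g where g: "g \<in> carrier G" "C = M #> g"
    by (auto simp: centralizer_def carrier_FactGroup)
  have "commutator G g h \<in> M" if h: "h \<in> carrier G" for h
  proof -
    have "M #> (g \<otimes> h) = M #> (h \<otimes> g)"
      using C(1) g h by (auto simp: centralizer_def carrier_FactGroup M.rcos_sum)
    then have "g \<otimes> h \<in> M #> (h \<otimes> g)"
      using rcos_self [OF _ M.subgroup_axioms, of "g \<otimes> h"] g h by simp
    then have "g \<otimes> h \<otimes> inv (h \<otimes> g) \<in> M"
      using g h by (intro M.rcos_module_imp) auto
    then show ?thesis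
      using g h by (simp add: commutator_def group_cancel)
  qed
  then have "g \<in> centre_modulo M"
    using g by (simp add: centre_modulo_def)
  moreover have "g \<notin> M"
    using C(2) g coset_join2 M.subgroup_axioms by blast
  ultimately show ?thesis
    using subset_centre_modulo [OF M(1)] by blast
qed

lemma comm_iter_carrier_eventually_trivial:
  "\<exists>k. comm_iter G (carrier G) (carrier G) k = {\<one>}"
proof (rule ccontr)
  let ?\<gamma> = "comm_iter G (carrier G) (carrier G)"
  define avoiding where "avoiding N \<longleftrightarrow> N \<lhd> G \<and> (\<forall>k. \<not> ?\<gamma> k \<subseteq> N)" for N
  assume nontrivial: "\<nexists>k. ?\<gamma> k = {\<one>}"
  have "\<one> \<in> ?\<gamma> k" for k
    by (rule one_in_comm_iter) simp
  with nontrivial have "\<forall>k. \<not> ?\<gamma> k \<subseteq> {\<one>}"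
    by blast
  then have "avoiding {\<one>}"
    by (simp add: avoiding_def one_is_normal)
  moreover have "finite {N. avoiding N}"
    unfolding avoiding_def by (rule finite_normal_subgroups)
  ultimately obtain M where M: "avoiding M" and maximal: "\<And>N. avoiding N \<Longrightarrow> M \<subseteq> N \<Longrightarrow> M = N"
    using finite_has_maximal [of "{N. avoiding N}"] by blast
  have M_normal: "M \<lhd> G" and not_subset: "\<not> ?\<gamma> k \<subseteq> M" for k
    using M by (simp_all add: avoiding_def)
  have "M \<noteq> carrier G"
    using not_subset [of 0] by auto
  then have "M \<subset> centre_modulo M"
    by (rule centre_modulo_psubset [OF M_normal])
  with maximal have "\<not> avoiding (centre_modulo M)"
    by blast
  then obtain k where "?\<gamma> k \<subseteq> centre_modulo M"
    using centre_modulo_is_normal [OF M_normal] by (auto simp: avoiding_def)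
  then have "?\<gamma> (Suc k) \<subseteq> commutator_subgroup G (centre_modulo M) (carrier G)"
    by (simp add: commutator_subgroup_mono)
  also have "\<dots> \<subseteq> M"
    by (rule commutator_subgroup_centre_modulo_subset [OF M_normal])
  finally show False
    using not_subset by blast
qed

lemma last_comm_iter_not_subset:
  assumes AB: "A \<subseteq> carrier G" "B \<subseteq> carrier G" and M: "\<one> \<in> M"
    and start: "\<not> comm_iter G A B i \<subseteq> M"
  obtains k where "i \<le> k" "\<not> comm_iter G A B k \<subseteq> M" "comm_iter G A B (Suc k) \<subseteq> M"
proof -
  obtain n where n: "comm_iter G (carrier G) (carrier G) n = {\<one>}"
    using comm_iter_carrier_eventually_trivial by blast
  have "comm_iter G A B (i + n) \<subseteq> comm_iter G (carrier G) (carrier G) (i + n)"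
    using AB by (rule comm_iter_mono)
  also have "\<dots> = {\<one>}"
    by (rule comm_iter_eq_one_mono [OF order_refl n]) simp
  finally have "comm_iter G A B (i + n) \<subseteq> M"
    using M by blast
  then obtain j where "\<not> comm_iter G A B (i + j) \<subseteq> M" "comm_iter G A B (i + Suc j) \<subseteq> M"
    using ex_least_nat_less [of "\<lambda>j. comm_iter G A B (i + j) \<subseteq> M" n] start
    by (metis add_0_right order_refl)
  then show thesis
    by (intro that [of "i + j"]) simp_all
qed

lemma self_centralizing_normal_subgroup_exists:
  obtains D where "D \<lhd> G" "centralizer G D = D"
proof -
  define abelian where "abelian N \<longleftrightarrow> N \<lhd> G \<and> N \<subseteq> centralizer G N" for N
  have "abelian {\<one>}"
    by (simp add: abelian_def one_is_normal centralizer_def)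
  moreover have "finite {N. abelian N}"
    unfolding abelian_def by (rule finite_normal_subgroups)
  ultimately obtain D where "abelian D" and maximal: "\<And>N. abelian N \<Longrightarrow> D \<subseteq> N \<Longrightarrow> D = N"
    using finite_has_maximal [of "{N. abelian N}"] by blast
  then have D: "D \<lhd> G" "D \<subseteq> centralizer G D"
    by (simp_all add: abelian_def)
  interpret D: normal D G by (rule D(1))
  let ?C = "centralizer G D"
  have "?C \<subseteq> D"
  proof (rule ccontr)
    assume "\<not> ?C \<subseteq> D"
    then obtain k where k: "\<not> comm_iter G ?C (carrier G) k \<subseteq> D" "comm_iter G ?C (carrier G) (Suc k) \<subseteq> D"
      using last_comm_iter_not_subset [of ?C "carrier G" D 0] centralizer_subset_carrier by auto
    then obtain g where g: "g \<in> comm_iter G ?C (carrier G) k" "g \<notin> D"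
      by blast
    have gC: "g \<in> ?C"
      using g(1) comm_iter_subset_normal [OF centralizer_is_normal [OF D(1)]] by blast
    have "commutator G g h \<in> D" if "h \<in> carrier G" for h
      using k(2) commutator_in_commutator_subgroup [OF g(1) that] by auto
    then have "abelian (generate G (insert g D))"
      using generate_insert_abelian_normal [OF D gC] by (simp add: abelian_def)
    then have "D = generate G (insert g D)"
      by (rule maximal) (auto intro: generate.incl)
    then show False
      using g(2) by (auto intro: generate.incl)
  qed
  with D that show thesis
    by blast
qed

end

section \<open>Thompson replacement\<close>

context group
begin

lemma elementary_abelian_imp_subgroup: "elementary_abelian G p E \<Longrightarrow> subgroup E G"
  by (simp add: elementary_abelian_def)

lemma elementary_abelian_subset_centralizer:
  assumes "elementary_abelian G p E"
  shows "E \<subseteq> centralizer G E"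
  using assms by (auto simp: elementary_abelian_def centralizer_def dest: subgroup.mem_carrier)

lemma elementary_abelian_subgroup:
  assumes "elementary_abelian G p E" "subgroup H G" "H \<subseteq> E"
  shows "elementary_abelian G p H"
  using assms unfolding elementary_abelian_def by blast

lemma elementary_abelian_generate:
  assumes T: "T \<subseteq> centralizer G T" and pow: "\<And>t. t \<in> T \<Longrightarrow> t [^] p = \<one>"
  shows "elementary_abelian G p (generate G T)"
proof -
  let ?H = "generate G T"
  have T_carrier: "T \<subseteq> carrier G"
    using T centralizer_subset_carrier by blast
  interpret H: subgroup ?H G
    by (rule generate_is_subgroup [OF T_carrier])
  have commute: "x \<otimes> y = y \<otimes> x" if "x \<in> ?H" "y \<in> ?H" for x y
    using that generate_abelian [OF T] by (auto simp: centralizer_def)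
  have "subgroup {x \<in> ?H. x [^] p = \<one>} G"
  proof (rule subgroupI)
    show "{x \<in> ?H. x [^] p = \<one>} \<noteq> {}"
      using H.one_closed nat_pow_one by blast
  qed (use commute in \<open>auto simp: nat_pow_inv pow_mult_distrib\<close>)
  then have "?H \<subseteq> {x \<in> ?H. x [^] p = \<one>}"
    using pow by (intro generate_subgroup_incl) (auto intro: generate.incl)
  then show ?thesis
    using commute H.subgroup_axioms by (auto simp: elementary_abelian_def)
qed

lemma elementary_abelian_set_mult:
  assumes E: "elementary_abelian G p E" and F: "elementary_abelian G p F"
    and EF: "F \<subseteq> centralizer G E"
  shows "elementary_abelian G p (E <#> F)"
proof (rule elementary_abelian_subgroup)
  note sub = E [THEN elementary_abelian_imp_subgroup] F [THEN elementary_abelian_imp_subgroup]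
  show "subgroup (E <#> F) G"
    using sub EF by (rule set_mult_commuting_is_subgroup)
  have "E \<union> F \<subseteq> centralizer G (E \<union> F)"
    using E F EF sub [THEN subgroup.subset]
    by (auto simp: elementary_abelian_def centralizer_def subset_iff)
  then show "elementary_abelian G p (generate G (E \<union> F))"
    using E F by (intro elementary_abelian_generate) (auto simp: elementary_abelian_def)
  show "E <#> F \<subseteq> generate G (E \<union> F)"
    by (auto simp: set_mult_def intro: generate.eng generate.incl)
qed

definition replacement :: "'a set \<Rightarrow> 'a \<Rightarrow> 'a set" where
  "replacement A x =
     commutator_subgroup G {x} A <#> (A \<inter> centralizer G (commutator_subgroup G {x} A))"

lemma replacement_factors_are_subgroups:
  assumes A: "subgroup A G" and x: "x \<in> carrier G"
  defines "M \<equiv> commutator_subgroup G {x} A"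
  shows "subgroup M G" "subgroup (A \<inter> centralizer G M) G"
proof -
  show "subgroup M G"
    unfolding M_def using x subgroup.subset [OF A] by (intro commutator_subgroup_is_subgroup) auto
  then show "subgroup (A \<inter> centralizer G M) G"
    by (intro subgroup_Int_centralizer A subgroup.subset)
qed

lemma replacement_is_subgroup:
  assumes "subgroup A G" "x \<in> carrier G"
  shows "subgroup (replacement A x) G"
  unfolding replacement_def
  by (intro set_mult_commuting_is_subgroup replacement_factors_are_subgroups assms) simp

lemma replacement_factors_subset:
  assumes "subgroup A G" "x \<in> carrier G"
  shows "commutator_subgroup G {x} A \<subseteq> replacement A x"
    and "A \<inter> centralizer G (commutator_subgroup G {x} A) \<subseteq> replacement A x"
  unfolding replacement_def
  by (intro subset_set_mult_left subset_set_mult_right subgroup.subset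
      replacement_factors_are_subgroups assms)+

lemma Int_subset_replacement:
  assumes A: "subgroup A G" and V: "V \<lhd> G" "V \<subseteq> centralizer G V" and x: "x \<in> V"
  shows "A \<inter> V \<subseteq> replacement A x"
proof -
  have "commutator_subgroup G {x} A \<subseteq> V"
    using x by (intro commutator_subgroup_subset_normal V(1) subgroup.subset [OF A]) simp
  then have "A \<inter> V \<subseteq> A \<inter> centralizer G (commutator_subgroup G {x} A)"
    using V(2) by (auto simp: centralizer_def)
  also have "\<dots> \<subseteq> replacement A x"
    using x V(2) centralizer_subset_carrier by (intro replacement_factors_subset A) blast
  finally show ?thesis .
qed

lemma elementary_abelian_replacement:
  assumes A: "elementary_abelian G p A" and V: "elementary_abelian G p V" "V \<lhd> G" and x: "x \<in> V"
  shows "elementary_abelian G p (replacement A x)"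
proof -
  let ?M = "commutator_subgroup G {x} A"
  have A_subgroup: "subgroup A G"
    by (rule elementary_abelian_imp_subgroup [OF A])
  have "x \<in> carrier G"
    using x V(2) by (meson normal_imp_subgroup subgroup.mem_carrier)
  note sub = replacement_factors_are_subgroups [OF A_subgroup this]
  have "?M \<subseteq> V"
    using x by (intro commutator_subgroup_subset_normal V(2) subgroup.subset [OF A_subgroup]) simp
  then have "elementary_abelian G p ?M"
    by (rule elementary_abelian_subgroup [OF V(1) sub(1)])
  moreover have "elementary_abelian G p (A \<inter> centralizer G ?M)"
    by (rule elementary_abelian_subgroup [OF A sub(2)]) simp
  ultimately show ?thesis
    unfolding replacement_def by (rule elementary_abelian_set_mult) simp
qed

lemma commutator_centralized_imp_mem_centralizer:
  assumes A: "A \<subseteq> centralizer G A" and V: "V \<lhd> G" "V \<subseteq> centralizer G V"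
    and x: "x \<in> V" and e: "e \<in> A" "commutator G x e \<in> centralizer G A"
  shows "e \<in> centralizer G (commutator_subgroup G {x} A)"
proof -
  interpret V: normal V G by (rule V(1))
  let ?K = "{commutator G a d | a d. a \<in> {x} \<and> d \<in> A}"
  have A_carrier: "A \<subseteq> carrier G"
    using A centralizer_subset_carrier by blast
  have "e \<otimes> commutator G x d = commutator G x d \<otimes> e" if d: "d \<in> A" for d
  proof -
    have carr: "d \<in> carrier G" "e \<in> carrier G"
      using A_carrier d e by auto
    have "d \<otimes> e = e \<otimes> d"
      using A d e by (auto simp: centralizer_def)
    then have "commutator G (commutator G x d) e = commutator G (commutator G x e) d"
      using carr by (intro commutator_commutator_commute [OF V x])
    also have "\<dots> = \<one>"
      using d e x carr by (subst commutator_eq_one_iff) (auto simp: centralizer_def)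
    finally show ?thesis
      using x carr by (simp add: commutator_eq_one_iff)
  qed
  then have "e \<in> centralizer G ?K"
    using e A_carrier by (auto simp: centralizer_def)
  moreover have "?K \<subseteq> carrier G"
    using x A_carrier by auto
  ultimately show ?thesis
    by (simp add: commutator_subgroup_eq centralizer_generate)
qed

lemma centralizer_coset_eq_of_commutator_coset_eq:
  fixes A x
  defines "C \<equiv> A \<inter> centralizer G (commutator_subgroup G {x} A)"
  assumes A: "subgroup A G" "A \<subseteq> centralizer G A"
    and V: "V \<lhd> G" "V \<subseteq> centralizer G V" and x: "x \<in> V" and ab: "a \<in> A" "b \<in> A"
    and eq: "C #> commutator G x a = C #> commutator G x b"
  shows "C #> a = C #> b"
proof -
  interpret A: subgroup A G by (rule A(1))
  interpret V: normal V G by (rule V(1))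
  have C: "subgroup C G"
    unfolding C_def by (rule replacement_factors_are_subgroups [OF A(1) V.mem_carrier [OF x]])
  interpret C: subgroup C G by (rule C)
  let ?e = "inv b \<otimes> a"
  have e: "?e \<in> A" "a = b \<otimes> ?e"
    using ab by (simp_all add: inv_mult_cancel)
  have xb: "commutator G x b \<in> V" and xa: "commutator G x a \<in> V"
    using x ab commutator_in_normal(1) [OF V(1)] by simp_all
  have "commutator G x a \<otimes> inv (commutator G x b) \<in> C"
    using rcos_self [OF _ C] eq xa xb by (intro C.rcos_module_imp) auto
  also have "commutator G x a \<otimes> inv (commutator G x b) = inv (commutator G x b) \<otimes> commutator G x a"
    using V(2) V.m_inv_closed [OF xb] xa by (auto simp: centralizer_def)
  also have "\<dots> = b \<otimes> commutator G x ?e \<otimes> inv b"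
    using x ab by (simp add: commutator_def group_cancel)
  finally have "b \<otimes> commutator G x ?e \<otimes> inv b \<in> A"
    by (simp add: C_def)
  then have "inv b \<otimes> (b \<otimes> commutator G x ?e \<otimes> inv b) \<otimes> b \<in> A"
    using ab by simp
  also have "inv b \<otimes> (b \<otimes> commutator G x ?e \<otimes> inv b) \<otimes> b = commutator G x ?e"
    using x ab by (simp add: group_cancel)
  finally have "?e \<in> C"
    using e(1) A(2) commutator_centralized_imp_mem_centralizer [OF A(2) V x]
    by (auto simp: C_def)
  moreover have "a = ?e \<otimes> b"
    using e A(2) ab by (auto simp: centralizer_def)
  ultimately have "a \<in> C #> b"
    by (auto simp: r_coset_def)
  then show ?thesis
    using repr_independence [OF _ _ C] ab by simp
qed

text \<open>The map \<open>a \<mapsto> [x, a]\<close> embeds the cosets of \<open>C\<^sub>A([x, A])\<close> in \<open>A\<close> into those in the replacement.\<close>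

lemma card_le_card_replacement:
  assumes A: "subgroup A G" "A \<subseteq> centralizer G A" and x: "x \<in> V"
    and V: "V \<lhd> G" "V \<subseteq> centralizer G V" and finite: "finite (replacement A x)"
  shows "card A \<le> card (replacement A x)"
proof -
  define M where "M = commutator_subgroup G {x} A"
  define C where "C = A \<inter> centralizer G M"
  have "x \<in> carrier G"
    using x V(2) centralizer_subset_carrier by blast
  note M_subset = replacement_factors_subset(1) [OF A(1) this, folded M_def]
    and C_subset = replacement_factors_subset(2) [OF A(1) this, folded M_def, folded C_def]
    and subgroups = replacement_is_subgroup [OF A(1) this]
      replacement_factors_are_subgroups(2) [OF A(1) this, folded M_def, folded C_def]
  have "card (rcosets\<^bsub>G\<lparr>carrier := A\<rparr>\<^esub> C) \<le> card (rcosets\<^bsub>G\<lparr>carrier := replacement A x\<rparr>\<^esub> C)"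
  proof (rule card_le_if_inj_on_rel)
    let ?r = "\<lambda>S T. \<exists>a\<in>A. S = C #> a \<and> T = C #> commutator G x a"
    show "finite (rcosets\<^bsub>G\<lparr>carrier := replacement A x\<rparr>\<^esub> C)"
      using finite by (simp add: RCOSETS_def)
    show "\<exists>T. T \<in> rcosets\<^bsub>G\<lparr>carrier := replacement A x\<rparr>\<^esub> C \<and> ?r S T"
      if S: "S \<in> rcosets\<^bsub>G\<lparr>carrier := A\<rparr>\<^esub> C" for S
    proof -
      obtain a where a: "a \<in> A" "S = C #> a"
        using S by (auto simp: RCOSETS_def)
      then have "commutator G x a \<in> replacement A x"
        using M_subset commutator_in_commutator_subgroup by (auto simp: M_def)
      with a show ?thesis
        by (auto simp: RCOSETS_def)
    qed
    fix S S' T assume "?r S T" "?r S' T"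
    then obtain a b where "a \<in> A" "b \<in> A" "S = C #> a" "S' = C #> b"
        "C #> commutator G x a = C #> commutator G x b"
      by blast
    then show "S = S'"
      using centralizer_coset_eq_of_commutator_coset_eq [OF A V x] unfolding C_def M_def by blast
  qed
  then have "card (rcosets\<^bsub>G\<lparr>carrier := A\<rparr>\<^esub> C) * card C
      \<le> card (rcosets\<^bsub>G\<lparr>carrier := replacement A x\<rparr>\<^esub> C) * card C"
    by (rule mult_le_mono1)
  moreover have "C \<subseteq> A"
    by (simp add: C_def)
  ultimately show ?thesis
    using C_subset subgroups by (simp add: lagrange_restrict A(1))
qed

lemma not_mem_replacement:
  assumes A: "subgroup A G" "A \<subseteq> centralizer G A" and x: "x \<in> carrier G"
    and xA: "commutator_subgroup G (commutator_subgroup G {x} A) A \<subseteq> centralizer G A"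
    and a: "a \<in> A" "commutator G x a \<notin> centralizer G A"
  shows "x \<notin> replacement A x"
proof
  let ?M = "commutator_subgroup G {x} A"
  assume "x \<in> replacement A x"
  then obtain m c where m: "m \<in> ?M" and c: "c \<in> A" and x_eq: "x = m \<otimes> c"
    by (auto simp: replacement_def set_mult_def)
  have carr: "c \<in> carrier G" "a \<in> carrier G"
    using A(1) c a(1) by (auto dest: subgroup.mem_carrier)
  have m_carrier: "m \<in> carrier G"
    using replacement_factors_are_subgroups(1) [OF A(1) x] m by (rule subgroup.mem_carrier)
  have "c \<otimes> a = a \<otimes> c"
    using A(2) c a(1) by (auto simp: centralizer_def)
  then have "commutator G c a = \<one>"
    using carr by (simp add: commutator_eq_one_iff)
  then have "commutator G x a = commutator G m a"
    using carr m_carrier by (simp add: x_eq commutator_mult_left)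
  also have "\<dots> \<in> centralizer G A"
    using xA commutator_in_commutator_subgroup [OF m a(1)] by blast
  finally show False
    using a(2) by contradiction
qed

end

context finite_p_group
begin

definition max_rank_elementary_abelian :: "'a set \<Rightarrow> bool" where
  "max_rank_elementary_abelian E \<longleftrightarrow> elementary_abelian G p E \<and> el_rank p E = p_rank G p"

lemma card_eq_power_el_rank:
  assumes "subgroup H G"
  shows "card H = p ^ el_rank p H"
proof -
  have "card H dvd order G"
    using lagrange [OF assms] by (metis dvd_triv_right)
  then obtain k where "card H = p ^ k"
    by (rule dvd_order_eq_prime_power)
  then show ?thesis
    using prime by (simp add: el_rank_def multiplicity_same_power prime_gt_1_nat)
qed

lemma el_rank_le_iff_card_le:
  assumes "subgroup H G" "subgroup K G"
  shows "el_rank p H \<le> el_rank p K \<longleftrightarrow> card H \<le> card K"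
  using prime_gt_1_nat [OF prime]
  by (simp add: card_eq_power_el_rank [OF assms(1)] card_eq_power_el_rank [OF assms(2)])

lemma el_rank_le_p_rank:
  assumes "elementary_abelian G p E"
  shows "el_rank p E \<le> p_rank G p"
  unfolding p_rank_def
proof (rule Max_ge)
  have "{E. elementary_abelian G p E} \<subseteq> Pow (carrier G)"
    by (auto simp: elementary_abelian_def dest: subgroup.mem_carrier)
  then have "finite {E. elementary_abelian G p E}"
    using finite_carrier finite_subset by blast
  then show "finite {el_rank p E | E. elementary_abelian G p E}"
    by simp
qed (use assms in blast)

lemma max_rank_elementary_abelian_iff_card:
  assumes "max_rank_elementary_abelian E" "elementary_abelian G p F"
  shows "max_rank_elementary_abelian F \<longleftrightarrow> card E \<le> card F"
  using assms el_rank_le_p_rank [OF assms(2)] el_rank_le_iff_card_le [of E F]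
  by (auto simp: max_rank_elementary_abelian_def elementary_abelian_imp_subgroup)

lemma max_rank_elementary_abelian_absorb:
  assumes E: "max_rank_elementary_abelian E" and F: "elementary_abelian G p F"
    and EF: "E \<subseteq> centralizer G F"
  shows "F \<subseteq> E"
proof -
  have E_ea: "elementary_abelian G p E"
    using E by (simp add: max_rank_elementary_abelian_def)
  note sub = E_ea [THEN elementary_abelian_imp_subgroup] F [THEN elementary_abelian_imp_subgroup]
  have product: "elementary_abelian G p (E <#> F)"
    by (intro elementary_abelian_set_mult E_ea F subset_centralizer_swap [OF EF] subgroup.subset sub)
  have "E \<subseteq> E <#> F" "F \<subseteq> E <#> F"
    using sub by (simp_all add: subset_set_mult_left subset_set_mult_right subgroup.subset)
  moreover have "card (E <#> F) \<le> card E"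
    using el_rank_le_p_rank [OF product] product E sub
    by (simp add: max_rank_elementary_abelian_def elementary_abelian_imp_subgroup
        flip: el_rank_le_iff_card_le)
  moreover have "finite (E <#> F)"
    using product by (intro finite_subgroup elementary_abelian_imp_subgroup)
  ultimately show ?thesis
    using card_seteq by blast
qed

lemma nonquadratic_witness_exists:
  assumes VA: "V \<subseteq> carrier G" "A \<subseteq> carrier G" and not_quadratic: "comm_iter G V A 2 \<noteq> {\<one>}"
  obtains i x a where "x \<in> comm_iter G V A i" "a \<in> A" "commutator G x a \<notin> centralizer G A"
    "comm_iter G V A (Suc (Suc i)) \<subseteq> centralizer G A"
proof -
  have CA: "subgroup (centralizer G A) G"
    by (rule centralizer_is_subgroup [OF VA(2)])
  have "\<not> comm_iter G V A 1 \<subseteq> centralizer G A"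
    using not_quadratic commutator_subgroup_eq_one_iff [OF comm_iter_subset_carrier [OF VA] VA(2), of 1]
    by (simp add: numeral_2_eq_2)
  then obtain k where "1 \<le> k" "\<not> comm_iter G V A k \<subseteq> centralizer G A"
      "comm_iter G V A (Suc k) \<subseteq> centralizer G A"
    using last_comm_iter_not_subset [OF VA subgroup.one_closed [OF CA]] by blast
  then obtain i where i: "\<not> comm_iter G V A (Suc i) \<subseteq> centralizer G A"
      "comm_iter G V A (Suc (Suc i)) \<subseteq> centralizer G A"
    by (cases k) auto
  then obtain x a where "x \<in> comm_iter G V A i" "a \<in> A" "commutator G x a \<notin> centralizer G A"
    using commutator_subgroup_subset [OF CA] by (metis comm_iter.simps(2))
  then show thesis
    using i(2) by (rule that)
qed

lemma thompson_replacement: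
  assumes A: "max_rank_elementary_abelian A"
    and V: "elementary_abelian G p V" "V \<lhd> G"
    and not_quadratic: "comm_iter G V A 2 \<noteq> {\<one>}"
  obtains A' where "max_rank_elementary_abelian A'" "A \<inter> V \<subset> A' \<inter> V" "\<not> A' \<subseteq> centralizer G V"
proof -
  interpret V: normal V G by (rule V(2))
  have A_ea: "elementary_abelian G p A"
    using A by (simp add: max_rank_elementary_abelian_def)
  interpret A: subgroup A G by (rule elementary_abelian_imp_subgroup [OF A_ea])
  note abelian = A_ea [THEN elementary_abelian_subset_centralizer]
    V(1) [THEN elementary_abelian_subset_centralizer]
  obtain i x a where x: "x \<in> comm_iter G V A i" and a: "a \<in> A" "commutator G x a \<notin> centralizer G A"
      and centralized: "comm_iter G V A (Suc (Suc i)) \<subseteq> centralizer G A"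
    by (rule nonquadratic_witness_exists [OF V.subset A.subset not_quadratic])
  have xV: "x \<in> V"
    using x comm_iter_subset_normal [OF V(2) order_refl A.subset] by blast
  let ?A' = "replacement A x"
  have "elementary_abelian G p ?A'"
    by (rule elementary_abelian_replacement [OF A_ea V xV])
  moreover have "card A \<le> card ?A'"
    using finite_subgroup [OF replacement_is_subgroup [OF A.subgroup_axioms V.mem_carrier [OF xV]]]
    by (rule card_le_card_replacement [OF A.subgroup_axioms abelian(1) xV V(2) abelian(2)])
  ultimately have max_rank: "max_rank_elementary_abelian ?A'"
    using max_rank_elementary_abelian_iff_card [OF A] by simp
  have "commutator G x a \<in> commutator_subgroup G {x} A"
    using a(1) by (intro commutator_in_commutator_subgroup) auto
  then have "commutator G x a \<in> ?A'" "commutator G x a \<in> V"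
    using replacement_factors_subset(1) [OF A.subgroup_axioms V.mem_carrier [OF xV]]
      commutator_in_normal(1) [OF V(2) xV] a(1) by auto
  then have "A \<inter> V \<subset> ?A' \<inter> V"
    using Int_subset_replacement [OF A.subgroup_axioms V(2) abelian(2) xV] a(2) abelian(1) by blast
  moreover have "commutator_subgroup G (commutator_subgroup G {x} A) A
      \<subseteq> comm_iter G V A (Suc (Suc i))"
    using x by (simp add: commutator_subgroup_mono)
  then have "x \<notin> ?A'"
    using xV centralized
    by (intro not_mem_replacement [OF _ abelian(1) _ _ a] A.subgroup_axioms) auto
  then have "\<not> ?A' \<subseteq> centralizer G V"
    using max_rank_elementary_abelian_absorb [OF max_rank V(1)] xV by blast
  ultimately show thesis
    using that max_rank by blast
qed

end

section \<open>The Oliver subgroup for odd \<open>p\<close>\<close>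

locale finite_odd_p_group = finite_p_group +
  assumes odd: "odd p"
begin

abbreviation \<XX> :: "'a set" where
  "\<XX> \<equiv> oliver_subgroup G p"

definition \<VV> :: "'a set" where
  "\<VV> = Omega1 G p (centralizer G \<XX>)"

lemmas \<XX>_chain = oliver_subgroup_greatest_chain(1) [OF finite_carrier]
  and chain_subset_\<XX> = oliver_subgroup_greatest_chain(2) [OF finite_carrier]

lemma \<XX>_normal: "\<XX> \<lhd> G"
  by (rule oliver_chain_normal [OF \<XX>_chain])

lemma \<XX>_subgroup: "subgroup \<XX> G"
  by (rule normal_imp_subgroup [OF \<XX>_normal])

lemma \<VV>_normal: "\<VV> \<lhd> G"
  unfolding \<VV>_def by (intro Omega1_is_normal centralizer_is_normal \<XX>_normal)

lemma \<VV>_subset_centralizer_\<XX>: "\<VV> \<subseteq> centralizer G \<XX>"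
  unfolding \<VV>_def
  by (intro Omega1_subset normal_imp_subgroup centralizer_is_normal \<XX>_normal)

lemma \<VV>_subset_carrier: "\<VV> \<subseteq> carrier G"
  using \<VV>_subset_centralizer_\<XX> centralizer_subset_carrier by blast

lemma comm_iter_\<VV>_eq_one_of_quadratic:
  assumes "R \<subseteq> carrier G" "comm_iter G \<VV> R 2 = {\<one>}"
  shows "comm_iter G \<VV> (\<XX> <#> R) (p - 1) = {\<one>}"
proof -
  have "2 \<le> p - 1"
    using prime_ge_2_nat [OF prime] odd by (cases "p = 2") auto
  with assms have "comm_iter G \<VV> R (p - 1) = {\<one>}"
    by (rule comm_iter_eq_one_mono)
  then show ?thesis
    using comm_iter_set_mult_centralized [OF \<XX>_normal \<VV>_subset_centralizer_\<XX> assms(1)] by simp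
qed

lemma quadratic_normal_subset_\<XX>:
  assumes R: "R \<lhd> G" and "comm_iter G \<VV> R 2 = {\<one>}"
  shows "R \<subseteq> \<XX>"
proof -
  interpret R: normal R G by (rule R)
  have incl: "\<XX> \<subseteq> \<XX> <#> R" "R \<subseteq> \<XX> <#> R"
    using \<XX>_subgroup R.subgroup_axioms
    by (simp_all add: subset_set_mult_left subset_set_mult_right subgroup.subset)
  moreover have "comm_iter G \<VV> (\<XX> <#> R) (p - 1) = {\<one>}"
    using assms(2) by (rule comm_iter_\<VV>_eq_one_of_quadratic [OF R.subset])
  ultimately have "oliver_step G p \<XX> (\<XX> <#> R)"
    using normal_subgroup_set_mult_closed [OF \<XX>_normal R]
    by (simp add: oliver_step_def \<VV>_def)
  then have "\<XX> <#> R \<subseteq> \<XX>"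
    by (intro chain_subset_\<XX> oliver_chain_step [OF \<XX>_chain])
  with incl(2) show ?thesis
    by blast
qed

lemma centralizer_\<XX>_subset: "centralizer G \<XX> \<subseteq> \<XX>"
proof -
  obtain D where D: "D \<lhd> G" "centralizer G D = D"
    by (rule self_centralizing_normal_subgroup_exists)
  have "comm_iter G \<VV> D 2 = {\<one>}"
    using D by (intro comm_iter_two_eq_one_of_abelian_normal \<VV>_subset_carrier) auto
  then have "D \<subseteq> \<XX>"
    by (rule quadratic_normal_subset_\<XX> [OF D(1)])
  then show ?thesis
    using centralizer_antimono D(2) by blast
qed

lemma \<VV>_elementary_abelian: "elementary_abelian G p \<VV>"
  unfolding \<VV>_def Omega1_def
proof (rule elementary_abelian_generate)
  let ?T = "{x \<in> centralizer G \<XX>. ord x = p}"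
  show "?T \<subseteq> centralizer G ?T"
    using centralizer_\<XX>_subset by (auto simp: centralizer_def)
qed (use centralizer_subset_carrier pow_ord_eq_1 in blast)

lemma centralizer_\<VV>: "centralizer G \<VV> = \<XX>"
proof
  have "commutator_subgroup G \<VV> (centralizer G \<VV>) = {\<one>}"
    using subset_centralizer_swap [OF order_refl \<VV>_subset_carrier] centralizer_subset_carrier
    by (subst commutator_subgroup_eq_one_iff [OF \<VV>_subset_carrier])
  then have "comm_iter G \<VV> (centralizer G \<VV>) 1 = {\<one>}"
    by simp
  then have "comm_iter G \<VV> (centralizer G \<VV>) 2 = {\<one>}"
    by (rule comm_iter_eq_one_mono [OF centralizer_subset_carrier]) simp
  then show "centralizer G \<VV> \<subseteq> \<XX>"
    by (intro quadratic_normal_subset_\<XX> centralizer_is_normal \<VV>_normal)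
  show "\<XX> \<subseteq> centralizer G \<VV>"
    using subset_centralizer_swap [OF \<VV>_subset_centralizer_\<XX> subgroup.subset [OF \<XX>_subgroup]] .
qed

lemma quadratic_max_rank_elementary_abelian_exists:
  assumes E: "max_rank_elementary_abelian E" "\<not> E \<subseteq> \<XX>"
  obtains A where "max_rank_elementary_abelian A" "\<not> A \<subseteq> \<XX>" "comm_iter G \<VV> A 2 = {\<one>}"
proof -
  define outside where "outside A \<longleftrightarrow> max_rank_elementary_abelian A \<and> \<not> A \<subseteq> \<XX>" for A
  let ?traces = "(\<lambda>A. A \<inter> \<VV>) ` Collect outside"
  have "finite (Pow \<VV>)"
    using finite_subgroup [OF normal_imp_subgroup [OF \<VV>_normal]] by simp
  then have "finite ?traces"
    by (rule finite_subset [rotated]) blast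
  moreover have "?traces \<noteq> {}"
    using E by (auto simp: outside_def)
  ultimately have "\<exists>T\<in>?traces. \<forall>T'\<in>?traces. T \<subseteq> T' \<longrightarrow> T = T'"
    by (rule finite_has_maximal)
  then obtain A where A: "outside A"
      and maximal: "\<forall>A'. outside A' \<longrightarrow> A \<inter> \<VV> \<subseteq> A' \<inter> \<VV> \<longrightarrow> A \<inter> \<VV> = A' \<inter> \<VV>"
    by auto
  have "comm_iter G \<VV> A 2 = {\<one>}"
  proof (rule ccontr)
    assume not_quadratic: "comm_iter G \<VV> A 2 \<noteq> {\<one>}"
    have "max_rank_elementary_abelian A"
      using A by (simp add: outside_def)
    then obtain A' where "max_rank_elementary_abelian A'" "A \<inter> \<VV> \<subset> A' \<inter> \<VV>"
        "\<not> A' \<subseteq> centralizer G \<VV>"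
      by (rule thompson_replacement [OF _ \<VV>_elementary_abelian \<VV>_normal not_quadratic])
    moreover from this have "outside A'"
      by (simp add: outside_def centralizer_\<VV>)
    ultimately show False
      using maximal by (metis psubset_eq)
  qed
  then show thesis
    using A that by (auto simp: outside_def)
qed

lemma oliver_subgroup_of_\<XX>: "oliver_subgroup (G\<lparr>carrier := \<XX>\<rparr>) p = \<XX>"
  by (intro oliver_subgroup_restrict_eqI \<XX>_subgroup finite_subgroup oliver_chain_restrict
      \<XX>_chain order_refl)

lemma oliver_subgroup_of_quadratic_extension:
  assumes A: "subgroup A G" and quadratic: "comm_iter G \<VV> A 2 = {\<one>}"
  shows "oliver_subgroup (G\<lparr>carrier := \<XX> <#> A\<rparr>) p = \<XX> <#> A"
proof -
  let ?L = "\<XX> <#> A"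
  have L: "subgroup ?L G"
    by (rule mult_norm_subgroup [OF \<XX>_normal A])
  interpret L: group "G\<lparr>carrier := ?L\<rparr>" by (rule subgroup_imp_group [OF L])
  have incl: "\<XX> \<subseteq> ?L"
    by (intro subset_set_mult_left A subgroup.subset \<XX>_subgroup)
  have "comm_iter G (Omega1 G p (centralizer G \<XX>)) ?L (p - 1) = {\<one>}"
    using comm_iter_\<VV>_eq_one_of_quadratic [OF subgroup.subset [OF A] quadratic]
    by (simp add: \<VV>_def)
  moreover have "?L \<lhd> G\<lparr>carrier := ?L\<rparr>"
    using L.normal_self by simp
  ultimately have "oliver_step (G\<lparr>carrier := ?L\<rparr>) p \<XX> ?L"
    by (intro oliver_step_restrictI L incl)
  then have "oliver_chain (G\<lparr>carrier := ?L\<rparr>) p ?L"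
    by (rule L.oliver_chain_step [OF oliver_chain_restrict [OF L \<XX>_chain incl]])
  then show ?thesis
    by (intro oliver_subgroup_restrict_eqI L finite_subgroup)
qed

lemma larger_self_oliver_subgroup_exists:
  assumes "\<not> thompson_subgroup G p \<subseteq> \<XX>"
  obtains L where "subgroup L G" "\<XX> \<subset> L" "L \<subseteq> thompson_subgroup G p <#> \<XX>"
    "oliver_subgroup (G\<lparr>carrier := L\<rparr>) p = L"
proof -
  have "\<not> \<Union>{E. max_rank_elementary_abelian E} \<subseteq> \<XX>"
    using assms generate_subgroup_incl [OF _ \<XX>_subgroup]
    unfolding thompson_subgroup_def max_rank_elementary_abelian_def by blast
  then obtain A where A: "max_rank_elementary_abelian A" "\<not> A \<subseteq> \<XX>" "comm_iter G \<VV> A 2 = {\<one>}"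
    using quadratic_max_rank_elementary_abelian_exists by blast
  have sub: "subgroup A G"
    using A(1) by (auto simp: max_rank_elementary_abelian_def intro: elementary_abelian_imp_subgroup)
  have "\<XX> \<subseteq> \<XX> <#> A" "A \<subseteq> \<XX> <#> A"
    using sub \<XX>_subgroup
    by (simp_all add: subset_set_mult_left subset_set_mult_right subgroup.subset)
  with A(2) have "\<XX> \<subset> \<XX> <#> A"
    by blast
  moreover have "A \<subseteq> thompson_subgroup G p"
    using A(1) by (auto simp: thompson_subgroup_def max_rank_elementary_abelian_def intro: generate.incl)
  then have "\<XX> <#> A \<subseteq> thompson_subgroup G p <#> \<XX>"
    unfolding commut_normal [OF sub \<XX>_normal, symmetric] by (rule mono_set_mult [OF _ order_refl])
  moreover have "oliver_subgroup (G\<lparr>carrier := \<XX> <#> A\<rparr>) p = \<XX> <#> A"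
    using sub A(3) by (rule oliver_subgroup_of_quadratic_extension)
  ultimately show thesis
    by (rule that [OF mult_norm_subgroup [OF \<XX>_normal sub]])
qed

end

theorem theorem1p4:
  fixes S :: "('a, 'b) monoid_scheme" and p :: nat
  assumes "p_group S p" and "odd p"
  shows "thompson_subgroup S p \<subseteq> oliver_subgroup S p \<longleftrightarrow>
         (\<forall>L. subgroup L S \<and> oliver_subgroup S p \<subseteq> L \<and>
              L \<subseteq> thompson_subgroup S p <#>\<^bsub>S\<^esub> oliver_subgroup S p \<longrightarrow>
              oliver_subgroup (S\<lparr>carrier := L\<rparr>) p = oliver_subgroup S p)"
    (is "?J \<subseteq> ?O \<longleftrightarrow> ?stable")
proof -
  interpret group S using assms(1) by (simp add: p_group_def)
  interpret finite_odd_p_group S p by unfold_locales (fact assms)+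
  show ?thesis
  proof
    assume "?J \<subseteq> ?O"
    then have "?J <#>\<^bsub>S\<^esub> ?O \<subseteq> ?O"
      using mono_set_mult [OF _ order_refl] subgroup_mult_id [OF \<XX>_subgroup] by metis
    then have "L = ?O" if "?O \<subseteq> L" "L \<subseteq> ?J <#>\<^bsub>S\<^esub> ?O" for L
      using that by blast
    then show ?stable
      using oliver_subgroup_of_\<XX> by blast
  next
    assume ?stable
    then have "\<not> ?O \<subset> L" if "subgroup L S" "L \<subseteq> ?J <#>\<^bsub>S\<^esub> ?O"
        "oliver_subgroup (S\<lparr>carrier := L\<rparr>) p = L" for L
      using that by (metis psubsetE order_refl)
    then show "?J \<subseteq> ?O"
      using larger_self_oliver_subgroup_exists by metis
  qed
qed

end
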